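(* Let $p\ge 3$ be an integer and let $K=2p\infty$ be the Hecke group, i.e. the group with presentation $$K=\langle X,Y : X^2=Y^p=e\rangle .$$ Then: (i) if $p$ is even, $K$ has exactly $3$ subgroups of index $2$; (ii) if $p$ is divisible by both $2$ and $3$, $K$ has exactly $3$ subgroups of index $3$ up to conjugacy in $K$; (iii) if $p$ is divisible by $2$, $3$ and $4$, $K$ has exactly $10$ subgroups of index $4$ up to conjugacy in $K$.
   Context: The Hecke group $H(\lambda_p)$, denoted $2p\infty$ in orbifold notation, is the group of linear fractional transformations generated by $X(z)=-1/z$ and $Y(z)=-1/(z+\lambda_p)$ with $\lambda_p=2\cos(\pi/p)$, $p\in\mathbb{N}$, $p\ge 3$; it has the presentation $\langle X,Y : X^2=Y^p=e\rangle$. Equivalently, it is the index $2$ subgroup, generated by $X=RP$ and $Y=QR$, of orientation-preserving elements of the extended Hecke group $\langle P,Q,R : P^2=Q^2=R^2=(RP)^2=(QR)^p=e\rangle$ generated by the reflections in the sides of a hyperbolic triangle with angles $\pi/2,\pi/p,0$. "Up to conjugacy in $K$" means that conjugate subgroups of $K$ are counted once. *)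

theory Defs
  imports "HOL-Algebra.Group_Action"
begin

section \<open>Groups given by generators and relators\<close>

text \<open>
  The letter \<open>(a, True)\<close> stands for the generator \<open>a\<close> and \<open>(a, False)\<close> for its formal inverse;
  the generators are all elements of the type \<open>'a\<close>.
\<close>

type_synonym 'a word = "('a \<times> bool) list"

text \<open>
  \<open>word_eq R u v\<close>: the words \<open>u\<close> and \<open>v\<close> represent the same element of the group with relators \<open>R\<close>.
  With \<open>R = {}\<close> this is equality in the free group.
\<close>

inductive word_eq :: "'a word set \<Rightarrow> 'a word \<Rightarrow> 'a word \<Rightarrow> bool"
  for R :: "'a word set"
where
  refl: "word_eq R u u"
| sym: "word_eq R u v \<Longrightarrow> word_eq R v u"
| trans: "word_eq R u v \<Longrightarrow> word_eq R v w \<Longrightarrow> word_eq R u w"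
| cancel: "word_eq R (u @ [(a, b), (a, \<not> b)] @ v) (u @ v)"
| relator: "r \<in> R \<Longrightarrow> word_eq R (u @ r @ v) (u @ v)"

definition word_class :: "'a word set \<Rightarrow> 'a word \<Rightarrow> 'a word set"
  where "word_class R u = {v. word_eq R u v}"

definition presented_group :: "'a word set \<Rightarrow> ('a word set) monoid"
  where "presented_group R =
    \<lparr>carrier = range (word_class R),
     monoid.mult = (\<lambda>A B. \<Union>u\<in>A. \<Union>v\<in>B. word_class R (u @ v)),
     one = word_class R []\<rparr>"

lemma word_eq_context: "word_eq R u v \<Longrightarrow> word_eq R (x @ u @ y) (x @ v @ y)"
proof (induction rule: word_eq.induct)
  case (cancel u a b v)
  show ?case using word_eq.cancel[of R "x @ u" a b "v @ y"] by simp
next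
  case (relator r u v)
  then show ?case using word_eq.relator[of r R "x @ u" "v @ y"] by simp
next
  case (sym u v)
  then show ?case by (blast intro: word_eq.sym)
next
  case (trans u v w)
  then show ?case by (blast intro: word_eq.trans)
qed (rule word_eq.refl)

lemma word_eq_append: "word_eq R u u' \<Longrightarrow> word_eq R v v' \<Longrightarrow> word_eq R (u @ v) (u' @ v')"
  using word_eq_context[of R u u' "[]" v] word_eq_context[of R v v' u' "[]"]
    word_eq.trans[of R "u @ v" "u' @ v" "u' @ v'"]
  by simp

lemma word_class_eq_iff: "word_class R u = word_class R v \<longleftrightarrow> word_eq R u v"
proof
  assume "word_class R u = word_class R v"
  moreover have "v \<in> word_class R v" by (simp add: word_class_def word_eq.refl)
  ultimately show "word_eq R u v" by (simp add: word_class_def set_eq_iff)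
next
  assume "word_eq R u v"
  then have "word_eq R u w \<longleftrightarrow> word_eq R v w" for w
    by (metis word_eq.sym word_eq.trans)
  then show "word_class R u = word_class R v" by (simp add: word_class_def)
qed

lemma presented_group_mult [simp]:
  "word_class R u \<otimes>\<^bsub>presented_group R\<^esub> word_class R v = word_class R (u @ v)"
proof -
  have "word_class R (u' @ v') = word_class R (u @ v)"
    if "u' \<in> word_class R u" "v' \<in> word_class R v" for u' v'
    unfolding word_class_eq_iff
    by (rule word_eq.sym[OF word_eq_append]) (use that in \<open>simp_all add: word_class_def\<close>)
  moreover have "u \<in> word_class R u" "v \<in> word_class R v"
    by (simp_all add: word_class_def word_eq.refl)
  ultimately have "(\<Union>u'\<in>word_class R u. \<Union>v'\<in>word_class R v. word_class R (u' @ v'))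
      = word_class R (u @ v)" by blast
  then show ?thesis by (simp add: presented_group_def)
qed

definition inv_word :: "'a word \<Rightarrow> 'a word"
  where "inv_word u = rev (map (\<lambda>(a, b). (a, \<not> b)) u)"

lemma word_eq_inv_word: "word_eq R (inv_word u @ u) []"
proof (induction u)
  case Nil
  show ?case by (simp add: inv_word_def word_eq.refl)
next
  case (Cons l u)
  obtain a b where l: "l = (a, b)" by force
  have "word_eq R (inv_word u @ [(a, \<not> b), (a, \<not> \<not> b)] @ u) (inv_word u @ u)"
    by (rule word_eq.cancel)
  from word_eq.trans[OF this Cons.IH] show ?case by (simp add: l inv_word_def)
qed

lemma presented_group_one: "\<one>\<^bsub>presented_group R\<^esub> = word_class R []"
  by (simp add: presented_group_def)

lemma presented_group_carrier: "carrier (presented_group R) = range (word_class R)"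
  by (simp add: presented_group_def)

lemma group_presented_group: "group (presented_group R)"
proof (rule groupI)
  show "\<exists>y\<in>carrier (presented_group R). y \<otimes>\<^bsub>presented_group R\<^esub> x = \<one>\<^bsub>presented_group R\<^esub>"
    if "x \<in> carrier (presented_group R)" for x
  proof -
    from that obtain u where "x = word_class R u" by (auto simp: presented_group_carrier)
    then have "word_class R (inv_word u) \<otimes>\<^bsub>presented_group R\<^esub> x = \<one>\<^bsub>presented_group R\<^esub>"
      by (simp add: presented_group_one word_class_eq_iff word_eq_inv_word)
    then show ?thesis by (auto simp: presented_group_carrier)
  qed
qed (auto simp: presented_group_carrier presented_group_one)

text \<open>Von Dyck's theorem, which characterizes the group defined by the relators \<open>R\<close>.\<close>

fun word_val :: "('g, 'm) monoid_scheme \<Rightarrow> ('a \<Rightarrow> 'g) \<Rightarrow> 'a word \<Rightarrow> 'g" where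
  "word_val G f [] = \<one>\<^bsub>G\<^esub>"
| "word_val G f ((a, b) # u) = (if b then f a else inv\<^bsub>G\<^esub> f a) \<otimes>\<^bsub>G\<^esub> word_val G f u"

lemma (in group) word_val_closed: "range f \<subseteq> carrier G \<Longrightarrow> word_val G f u \<in> carrier G"
proof (induction u)
  case (Cons l u)
  obtain a b where l: "l = (a, b)" by force
  have "f a \<in> carrier G" using Cons.prems by auto
  then show ?case by (simp add: l Cons)
qed simp

lemma (in group) word_val_append:
  assumes "range f \<subseteq> carrier G"
  shows "word_val G f (u @ v) = word_val G f u \<otimes> word_val G f v"
proof (induction u)
  case Nil
  show ?case by (simp add: word_val_closed assms)
next
  case (Cons l u)
  obtain a b where l: "l = (a, b)" by force
  have "f a \<in> carrier G" using assms by auto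
  then show ?case by (simp add: l Cons.IH m_assoc word_val_closed assms)
qed

lemma (in group) word_val_cong:
  assumes f: "range f \<subseteq> carrier G" and R: "\<And>r. r \<in> R \<Longrightarrow> word_val G f r = \<one>"
  shows "word_eq R u v \<Longrightarrow> word_val G f u = word_val G f v"
proof (induction rule: word_eq.induct)
  case (cancel u a b v)
  have fa: "f a \<in> carrier G" using f by auto
  have V: "word_val G f v \<in> carrier G" by (rule word_val_closed[OF f])
  have "word_val G f ([(a, b), (a, \<not> b)] @ v) = word_val G f v"
    using m_assoc[OF fa inv_closed[OF fa] V] m_assoc[OF inv_closed[OF fa] fa V]
    by (cases b) (simp_all add: fa V)
  then show ?case by (simp only: word_val_append[OF f])
next
  case (relator r u v)
  then show ?case by (simp add: word_val_append word_val_closed f R)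
qed simp_all

lemma (in group) von_dyck:
  assumes f: "range f \<subseteq> carrier G" and R: "\<And>r. r \<in> R \<Longrightarrow> word_val G f r = \<one>"
  shows "\<exists>h \<in> hom (presented_group R) G. \<forall>a. h (word_class R [(a, True)]) = f a"
proof -
  define h where "h A = word_val G f (SOME u. u \<in> A)" for A
  have h: "h (word_class R u) = word_val G f u" for u
  proof -
    have "u \<in> word_class R u" by (simp add: word_class_def word_eq.refl)
    then have "(SOME v. v \<in> word_class R u) \<in> word_class R u" by (rule someI)
    then show ?thesis unfolding h_def
      using word_val_cong[OF f R] by (simp add: word_class_def)
  qed
  have fa: "f a \<in> carrier G" for a using f by auto
  have "h \<in> hom (presented_group R) G"
    by (auto simp: hom_def presented_group_carrier h word_val_closed f word_val_append)
  moreover have "h (word_class R [(a, True)]) = f a" for a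
    by (simp add: h fa)
  ultimately show ?thesis by blast
qed


section \<open>The Hecke group\<close>

datatype hecke_gen = X | Y

definition hecke_presentation :: "nat \<Rightarrow> (hecke_gen word set) monoid"
  where "hecke_presentation p =
    presented_group {replicate 2 (X, True), replicate p (Y, True)}"


section \<open>Subgroups of a given index, up to conjugacy\<close>

text \<open>Only meaningful for \<open>n > 0\<close>, since \<open>card\<close> is 0 on infinite sets.\<close>

definition subgroups_of_index :: "('g, 'm) monoid_scheme \<Rightarrow> nat \<Rightarrow> 'g set set"
  where "subgroups_of_index G n = {H. subgroup H G \<and> card (rcosets\<^bsub>G\<^esub> H) = n}"

definition conjugacy_classes_of_index :: "('g, 'm) monoid_scheme \<Rightarrow> nat \<Rightarrow> 'g set set set"
  where "conjugacy_classes_of_index G n =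
    orbits G (subgroups_of_index G n) (\<lambda>g H. g <#\<^bsub>G\<^esub> H #>\<^bsub>G\<^esub> inv\<^bsub>G\<^esub> g)"

end

theory Submission
  imports Defs "HOL-Algebra.Generated_Groups"
begin

text \<open>
  Subgroups of index \<open>n\<close> up to conjugacy are the same as transitive actions on \<open>n\<close> points up to
  isomorphism: a subgroup is a point stabilizer of the action on its cosets
  (\<open>action_on_cosets\<close>), and a common stabilizer makes two transitive actions isomorphic
  (\<open>stabilizers_eq_imp_isomorphic_actions\<close>).  For \<open>K = \<langle>a, b | a\<^sup>2 = b\<^sup>p = e\<rangle>\<close> an action on
  \<open>{0, \<dots>, n - 1}\<close> is the same as a pair of permutations \<open>x\<close>, \<open>y\<close> with \<open>x\<^sup>2 = y\<^sup>p = id\<close>, and isomorphism of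
  actions is simultaneous conjugation of the pairs.  Hence the number of conjugacy classes is the
  number of transitive pairs up to renumbering of the points (\<open>card_conjugacy_classes_of_index\<close>).

  In the three cases \<open>p\<close> is a multiple of the exponent of the symmetric group on \<open>n\<close> points, which is
  2, 6 and 12 for \<open>n = 2, 3, 4\<close>.  So \<open>y\<close> ranges over all permutations, and what remains is a finite
  enumeration: the lists of representatives for \<open>n = 2, 3, 4\<close> have 3, 3 and 10 entries, and it is
  checked by evaluation that every transitive pair with \<open>x\<^sup>2 = id\<close> renumbers to an entry and that no
  two entries renumber to each other.  Subgroups of index 2 are normal, so there counting classes
  is counting subgroups.
\<close>


section \<open>Transitive actions and their stabilizers\<close>

lemma (in group) group_actionI:
  assumes ext: "\<And>g. g \<in> carrier G \<Longrightarrow> \<phi> g \<in> extensional E"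
    and closed: "\<And>g i. g \<in> carrier G \<Longrightarrow> i \<in> E \<Longrightarrow> \<phi> g i \<in> E"
    and one: "\<And>i. i \<in> E \<Longrightarrow> \<phi> \<one> i = i"
    and mult: "\<And>g h i. g \<in> carrier G \<Longrightarrow> h \<in> carrier G \<Longrightarrow> i \<in> E \<Longrightarrow> \<phi> (g \<otimes> h) i = \<phi> g (\<phi> h i)"
  shows "group_action G E \<phi>"
proof -
  have "bij_betw (\<phi> g) E E" if g: "g \<in> carrier G" for g
    using g closed one mult[of "inv g" g] mult[of g "inv g"]
    by (intro bij_betw_byWitness[where f' = "\<phi> (inv g)"]) auto
  with ext have Bij: "\<phi> g \<in> Bij E" if "g \<in> carrier G" for g
    using that by (simp add: Bij_def)
  have "\<phi> (g \<otimes> h) = compose E (\<phi> g) (\<phi> h)" if "g \<in> carrier G" "h \<in> carrier G" for g h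
    using that ext mult by (intro extensionalityI[where A = E]) (auto simp: compose_eq)
  with Bij have "\<phi> \<in> hom G (BijGroup E)"
    by (auto simp: hom_def BijGroup_def)
  then show ?thesis
    by (intro group_action.intro group_hom.intro group_hom_axioms.intro group_BijGroup is_group)
qed

lemma (in group_action) image_one: "i \<in> E \<Longrightarrow> \<phi> \<one> i = i"
  by (simp flip: id_eq_one)

text \<open>
  Along an orbit the stabilizers are conjugate by the very element that moves the point; for a
  transitive action the conjugates of one point stabilizer are therefore all the point stabilizers.
\<close>
lemma (in group_action) conjugate_stabilizer:
  assumes g: "g \<in> carrier G" and i: "i \<in> E"
  shows "g <# stabilizer G \<phi> i #> inv g = stabilizer G \<phi> (\<phi> g i)"
proof -
  interpret group G using group_hom group_hom.axioms(1) by auto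
  have gi: "\<phi> g i \<in> E" using element_image[OF g i] by simp
  have undo: "\<phi> (inv g) (\<phi> g i) = i" using orbit_sym_aux[OF g i] by simp
  have "g \<otimes> h \<otimes> inv g \<in> stabilizer G \<phi> (\<phi> g i)" if "h \<in> stabilizer G \<phi> i" for h
    using that g i gi undo by (simp add: stabilizer_def composition_rule)
  moreover have "\<exists>h \<in> stabilizer G \<phi> i. k = g \<otimes> h \<otimes> inv g"
    if k: "k \<in> stabilizer G \<phi> (\<phi> g i)" for k
  proof
    have kc: "k \<in> carrier G" using k by (simp add: stabilizer_def)
    show "inv g \<otimes> k \<otimes> g \<in> stabilizer G \<phi> i"
      using k g i gi undo by (simp add: stabilizer_def composition_rule)
    show "k = g \<otimes> (inv g \<otimes> k \<otimes> g) \<otimes> inv g"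
      using g kc by (simp add: m_assoc) (simp flip: m_assoc)
  qed
  ultimately show ?thesis
    by (auto simp: l_coset_def r_coset_def)
qed

lemma (in transitive_action) index_stabilizer:
  assumes "i \<in> E"
  shows "card (rcosets (stabilizer G \<phi> i)) = card E"
proof -
  have "orbit G \<phi> i = E"
    using unique_orbit[OF assms] element_image[OF _ assms] by (force simp: orbit_def)
  with orbit_stab_fun_is_bij[OF assms] show ?thesis by (simp add: bij_betw_same_card)
qed

text \<open>
  Every subgroup \<open>H\<close> of finite index \<open>n\<close> is a point stabilizer: number the cosets by \<open>0, \<dots>, n - 1\<close> and
  let \<open>g\<close> act on them by right multiplication with \<open>inv g\<close>, which makes it a left action.  The number of
  the coset \<open>H\<close> is left open, because only the conjugacy class of \<open>H\<close> is going to matter.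
\<close>
lemma (in group) action_on_cosets:
  assumes H: "subgroup H G" and n: "card (rcosets H) = n" "n > 0"
  shows "\<exists>\<phi>. transitive_action G {..<n} \<phi> \<and> (\<exists>k<n. stabilizer G \<phi> k = H)"
proof -
  have HG: "H \<subseteq> carrier G" by (rule subgroup.subset[OF H])
  have "finite (rcosets H)" using n by (meson card_gt_0_iff)
  then obtain e where e: "bij_betw e {..<n} (rcosets H)"
    using ex_bij_betw_nat_finite n(1) by (metis atLeast0LessThan)
  define d where "d = inv_into {..<n} e"
  have ed: "e (d C) = C" and d: "d C < n" if "C \<in> rcosets H" for C
    using e that bij_betw_inv_into_right[OF e] bij_betwE[OF bij_betw_inv_into[OF e]]
    by (auto simp: d_def)
  have de: "d (e i) = i" if "i < n" for i
    using bij_betw_inv_into_left[OF e] that by (simp add: d_def)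
  have e_coset: "e i \<in> rcosets H" if "i < n" for i using bij_betwE[OF e] that by auto
  have sub: "C \<subseteq> carrier G" if "C \<in> rcosets H" for C
    using subgroup.rcosets_carrier[OF H is_group that] .
  have shift: "C #> g \<in> rcosets H" if C: "C \<in> rcosets H" and g: "g \<in> carrier G" for C g
  proof -
    obtain h where "h \<in> carrier G" "C = H #> h" using C by (auto simp: RCOSETS_def)
    then show ?thesis
      using g rcosetsI[OF HG m_closed[of h g]] by (simp add: coset_mult_assoc HG)
  qed
  define \<phi> where "\<phi> g = (\<lambda>i\<in>{..<n}. d (e i #> inv g))" for g
  have \<phi>: "\<phi> g i = d (e i #> inv g)" if "i < n" for g i using that by (simp add: \<phi>_def)
  interpret group_action G "{..<n}" \<phi>
  proof (rule group_actionI)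
    fix g h i assume g: "g \<in> carrier G" "h \<in> carrier G" "i \<in> {..<n}"
    then have "e i #> inv h \<in> rcosets H" by (auto intro: e_coset shift)
    with g show "\<phi> (g \<otimes> h) i = \<phi> g (\<phi> h i)"
      by (simp add: \<phi> d ed inv_mult_group coset_mult_assoc sub e_coset)
  qed (auto simp: \<phi> d de e_coset shift sub coset_mult_one, simp add: \<phi>_def)
  have "transitive_action G {..<n} \<phi>"
  proof
    fix i j assume ij: "i \<in> {..<n}" "j \<in> {..<n}"
    then obtain g h where gh: "g \<in> carrier G" "h \<in> carrier G" "e i = H #> g" "e j = H #> h"
      using e_coset[of i] e_coset[of j] unfolding RCOSETS_def by blast
    then have "e i #> inv (inv h \<otimes> g) = e j"
      using HG by (simp add: coset_mult_assoc inv_mult_group flip: m_assoc)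
    then have "\<phi> (inv h \<otimes> g) i = j" using ij by (simp add: \<phi> de)
    then show "\<exists>g\<in>carrier G. \<phi> g i = j" using gh by blast
  qed
  moreover have "stabilizer G \<phi> (d H) = H" and "d H < n"
  proof -
    have Hr: "H \<in> rcosets H" by (rule subgroup.subgroup_in_rcosets[OF H is_group])
    then show dn: "d H < n" by (rule d)
    have "\<phi> g (d H) = d H \<longleftrightarrow> g \<in> H" if g: "g \<in> carrier G" for g
    proof -
      have "\<phi> g (d H) = d H \<longleftrightarrow> H #> inv g = H"
        using dn Hr g by (metis \<phi> ed inv_closed shift)
      also have "\<dots> \<longleftrightarrow> inv g \<in> H"
        using coset_join1[of H "inv g"] coset_join2[of "inv g" H] H g HG by auto
      also have "\<dots> \<longleftrightarrow> g \<in> H"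
        using g subgroup.m_inv_closed[OF H] by force
      finally show ?thesis .
    qed
    then show "stabilizer G \<phi> (d H) = H" using HG by (auto simp: stabilizer_def)
  qed
  ultimately show ?thesis by blast
qed

text \<open>
  A transitive action is determined by a point stabilizer: \<open>\<phi> g i \<mapsto> \<psi> g j\<close> is well defined and
  injective because \<open>\<phi> g i = \<phi> h i\<close> says that \<open>inv h \<otimes> g\<close> fixes \<open>i\<close>.
\<close>
lemma stabilizers_eq_imp_isomorphic_actions:
  fixes G (structure)
  assumes \<phi>: "transitive_action G E \<phi>" and \<psi>: "transitive_action G F \<psi>"
    and i: "i \<in> E" and j: "j \<in> F" and stab: "stabilizer G \<phi> i = stabilizer G \<psi> j"
  shows "\<exists>\<sigma>. bij_betw \<sigma> E F \<and> \<sigma> i = j \<and> (\<forall>g\<in>carrier G. \<forall>e\<in>E. \<sigma> (\<phi> g e) = \<psi> g (\<sigma> e))"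
proof -
  interpret \<phi>: transitive_action G E \<phi> by fact
  interpret \<psi>: transitive_action G F \<psi> by fact
  interpret group G using \<phi>.group_hom group_hom.axioms(1) by auto
  have same: "\<phi> g i = \<phi> h i \<longleftrightarrow> \<psi> g j = \<psi> h j" if gh: "g \<in> carrier G" "h \<in> carrier G" for g h
  proof -
    have "\<phi> g i = \<phi> h i \<longleftrightarrow> inv h \<otimes> g \<in> stabilizer G \<phi> i"
      using gh i \<phi>.orbit_sym_aux[of h i] \<phi>.orbit_sym_aux[of "inv h" "\<phi> g i"] \<phi>.element_image[of g i]
      by (auto simp: stabilizer_def \<phi>.composition_rule)
    moreover have "\<psi> g j = \<psi> h j \<longleftrightarrow> inv h \<otimes> g \<in> stabilizer G \<psi> j"
      using gh j \<psi>.orbit_sym_aux[of h j] \<psi>.orbit_sym_aux[of "inv h" "\<psi> g j"] \<psi>.element_image[of g j]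
      by (auto simp: stabilizer_def \<psi>.composition_rule)
    ultimately show ?thesis by (simp add: stab)
  qed
  obtain t where t: "\<And>e. e \<in> E \<Longrightarrow> t e \<in> carrier G \<and> \<phi> (t e) i = e"
    using \<phi>.unique_orbit[OF i] by metis
  define \<sigma> where "\<sigma> e = \<psi> (t e) j" for e
  have \<sigma>: "\<sigma> (\<phi> g i) = \<psi> g j" if "g \<in> carrier G" for g
    unfolding \<sigma>_def using t[of "\<phi> g i"] \<phi>.element_image[OF that i] same[of "t (\<phi> g i)" g] that by auto
  have "inj_on \<sigma> E"
    using t same by (intro inj_onI) (metis \<sigma>_def)
  moreover have "\<sigma> ` E = F"
  proof
    show "\<sigma> ` E \<subseteq> F" using t j \<psi>.element_image by (auto simp: \<sigma>_def)
    show "F \<subseteq> \<sigma> ` E"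
      using \<psi>.unique_orbit[OF j] \<sigma> \<phi>.element_image[OF _ i] by (metis image_eqI subsetI)
  qed
  moreover have "\<sigma> i = j"
    using \<sigma>[OF one_closed] i j by (simp add: \<phi>.image_one \<psi>.image_one)
  moreover have "\<sigma> (\<phi> g e) = \<psi> g (\<sigma> e)" if "g \<in> carrier G" "e \<in> E" for g e
    using \<sigma>[of "g \<otimes> t e"] t[OF that(2)] that i j
    by (simp add: \<phi>.composition_rule \<psi>.composition_rule \<sigma>_def)
  ultimately show ?thesis unfolding bij_betw_def by blast
qed

lemma stabilizer_eq_if_equivariant:
  assumes \<phi>: "group_action G E \<phi>" and \<sigma>: "inj_on \<sigma> E" and i: "i \<in> E"
    and eq: "\<And>g. g \<in> carrier G \<Longrightarrow> \<sigma> (\<phi> g i) = \<psi> g (\<sigma> i)"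
  shows "stabilizer G \<psi> (\<sigma> i) = stabilizer G \<phi> i"
proof -
  have "\<phi> g i = i \<longleftrightarrow> \<psi> g (\<sigma> i) = \<sigma> i" if "g \<in> carrier G" for g
    using that group_action.element_image[OF \<phi> that i] \<sigma> i
    by (auto simp flip: eq dest: inj_onD)
  then show ?thesis by (auto simp: stabilizer_def)
qed

lemma equivariant_if_on_generators:
  fixes G (structure)
  assumes \<phi>: "group_action G E \<phi>" and \<psi>: "group_action G F \<psi>" and A: "A \<subseteq> carrier G"
    and \<sigma>: "\<And>e. e \<in> E \<Longrightarrow> \<sigma> e \<in> F"
    and gen: "\<And>g e. g \<in> A \<Longrightarrow> e \<in> E \<Longrightarrow> \<sigma> (\<phi> g e) = \<psi> g (\<sigma> e)"
  shows "g \<in> generate G A \<Longrightarrow> e \<in> E \<Longrightarrow> \<sigma> (\<phi> g e) = \<psi> g (\<sigma> e)"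
proof -
  interpret \<phi>: group_action G E \<phi> by fact
  interpret \<psi>: group_action G F \<psi> by fact
  interpret group G using \<phi>.group_hom group_hom.axioms(1) by auto
  show "g \<in> generate G A \<Longrightarrow> e \<in> E \<Longrightarrow> \<sigma> (\<phi> g e) = \<psi> g (\<sigma> e)"
  proof (induction g arbitrary: e rule: generate.induct)
    case one
    then show ?case by (simp add: \<phi>.image_one \<psi>.image_one \<sigma>)
  next
    case (incl h)
    then show ?case by (simp add: gen)
  next
    case (inv h)
    then have h: "h \<in> carrier G" using A by auto
    have e': "\<phi> (inv h) e \<in> E" using h inv \<phi>.element_image[of "inv h" e] by simp
    have "\<phi> h (\<phi> (inv h) e) = e"
      using \<phi>.orbit_sym_aux[of "inv h" e] h inv by simp
    then have "\<sigma> e = \<psi> h (\<sigma> (\<phi> (inv h) e))" using gen[OF inv(1) e'] by simp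
    then show ?case
      using \<psi>.orbit_sym_aux[of h "\<sigma> (\<phi> (inv h) e)"] h \<sigma>[OF e'] by simp
  next
    case (eng g h)
    then show ?case
      using generate_in_carrier[OF A] \<phi>.element_image[of h e]
      by (simp add: \<phi>.composition_rule \<psi>.composition_rule \<sigma>)
  qed
qed

text \<open>
  For finite \<open>T\<close> inverses come for free: an injection of \<open>T\<close> into itself is onto.
\<close>
lemma (in group_action) closed_if_closed_under_generators:
  assumes A: "A \<subseteq> carrier G" and T: "T \<subseteq> E" "finite T"
    and gen: "\<And>g. g \<in> A \<Longrightarrow> \<phi> g ` T \<subseteq> T"
  shows "g \<in> generate G A \<Longrightarrow> \<phi> g ` T \<subseteq> T"
proof (induction g rule: generate.induct)
  case one
  then show ?case using T image_one by auto
next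
  case (incl h)
  then show ?case by (rule gen)
next
  case (inv h)
  then have h: "h \<in> carrier G" using A by auto
  have "\<phi> h ` T = T"
    by (rule endo_inj_surj[OF T(2) gen[OF inv] inj_on_subset[OF inj_prop[OF h] T(1)]])
  show ?case
  proof (rule image_subsetI)
    fix i assume "i \<in> T"
    then have "i \<in> \<phi> h ` T" by (simp only: \<open>\<phi> h ` T = T\<close>)
    then obtain j where j: "j \<in> T" "i = \<phi> h j" by (rule imageE) simp
    have "\<phi> (inv h) i = j" by (rule orbit_sym_aux[OF h]) (use j T(1) in auto)
    with j show "\<phi> (inv h) i \<in> T" by (simp only:)
  qed
next
  case (eng g h)
  interpret group G using group_hom group_hom.axioms(1) by auto
  show ?case
  proof (rule image_subsetI)
    fix i assume i: "i \<in> T"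
    then have "\<phi> (g \<otimes> h) i = \<phi> g (\<phi> h i)"
      using eng(1,2) generate_in_carrier[OF A] T(1) by (intro composition_rule) auto
    then show "\<phi> (g \<otimes> h) i \<in> T" using eng(3,4) i by auto
  qed
qed

lemma orbit_stabilizer_conjugation:
  fixes G (structure)
  assumes "transitive_action G E \<phi>" and i: "i \<in> E"
  shows "orbit G (\<lambda>g H. g <# H #> inv g) (stabilizer G \<phi> i) = stabilizer G \<phi> ` E"
proof -
  interpret transitive_action G E \<phi> by fact
  have "orbit G (\<lambda>g H. g <# H #> inv g) (stabilizer G \<phi> i) = {stabilizer G \<phi> (\<phi> g i) |g. g \<in> carrier G}"
    unfolding orbit_def using conjugate_stabilizer[OF _ i] by blast
  also have "\<dots> = stabilizer G \<phi> ` E"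
    using unique_orbit[OF i] element_image[OF _ i] by (auto simp: image_iff)
  finally show ?thesis .
qed

lemma (in transitive_action) stabilizer_in_subgroups_of_index:
  "i \<in> E \<Longrightarrow> stabilizer G \<phi> i \<in> subgroups_of_index G (card E)"
  by (simp add: subgroups_of_index_def stabilizer_subgroup index_stabilizer)

text \<open>
  Subgroups of index 2 are normal: in an action on two points, what fixes one point fixes the other.
  So the conjugacy classes are singletons.
\<close>
lemma (in group) card_subgroups_of_index_2:
  "card (subgroups_of_index G 2) = card (conjugacy_classes_of_index G 2)"
proof -
  have "orbit G (\<lambda>g H. g <# H #> inv g) H = {H}"
    if H: "H \<in> subgroups_of_index G 2" for H
  proof -
    obtain \<phi> k where \<phi>: "transitive_action G {..<2::nat} \<phi>" and k: "k < 2" "stabilizer G \<phi> k = H"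
      using action_on_cosets[of H 2] H by (auto simp: subgroups_of_index_def)
    interpret transitive_action G "{..<2}" \<phi> by fact
    have "\<phi> g 0 = 0 \<longleftrightarrow> \<phi> g 1 = 1" if g: "g \<in> carrier G" for g
      using inj_onD[OF inj_prop[OF g], of 0 1] element_image[OF g, of 0] element_image[OF g, of 1]
      by (auto simp: less_2_cases_iff)
    then have "stabilizer G \<phi> 0 = stabilizer G \<phi> 1" by (auto simp: stabilizer_def)
    moreover have "k = 0 \<or> k = 1" using k by auto
    moreover have "{..<2} = {0, 1::nat}" by auto
    ultimately have "stabilizer G \<phi> ` {..<2} = {H}" using k(2) by (elim disjE) simp_all
    then show ?thesis using orbit_stabilizer_conjugation[OF \<phi>, of k] k by simp
  qed
  then have "conjugacy_classes_of_index G 2 = (\<lambda>H. {H}) ` subgroups_of_index G 2"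
    by (auto simp: conjugacy_classes_of_index_def orbits_def image_iff)
  then show ?thesis by (simp add: card_image)
qed


section \<open>Pairs of permutations up to renumbering\<close>

text \<open>
  A table \<open>(xs, ys)\<close> lists the images of \<open>0, \<dots>, n - 1\<close> under two permutations; for the action of the
  Hecke group on cosets these are the actions of the two generators.
\<close>
type_synonym table = "nat list \<times> nat list"

definition perms :: "nat \<Rightarrow> nat list list" where
  "perms n = filter distinct (List.n_lists n [0..<n])"

definition involutive :: "nat list \<Rightarrow> bool" where
  "involutive xs \<longleftrightarrow> map ((!) xs) xs = [0..<length xs]"

text \<open>
  The order of the permutation \<open>ys\<close> divides \<open>m\<close>: since \<open>map ((!) ys)\<close> composes a list with \<open>ys\<close>, its
  \<open>m\<close>-th iterate turns the identity list into \<open>ys\<close> to the power \<open>m\<close>.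
\<close>
definition order_dvd :: "nat \<Rightarrow> nat list \<Rightarrow> bool" where
  "order_dvd m ys \<longleftrightarrow> (map ((!) ys) ^^ m) [0..<length ys] = [0..<length ys]"

text \<open>
  Transitivity in a form that can be evaluated: no proper subset that contains the point \<open>0\<close> is
  closed under both permutations.
\<close>
fun transitive_table :: "table \<Rightarrow> bool" where
  "transitive_table (xs, ys) \<longleftrightarrow>
    (\<forall>T\<in>set (subseqs [0..<length xs]). 0 \<in> set T \<longrightarrow> (\<forall>i\<in>set T. xs ! i \<in> set T \<and> ys ! i \<in> set T)
      \<longrightarrow> (\<forall>i\<in>set [0..<length xs]. i \<in> set T))"

text \<open>
  The renumbering \<open>ss\<close> of the points turns the first table into the second.  Composing lists
  instead of comparing values point by point keeps the evaluation short.
\<close>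
fun relabels :: "nat list \<Rightarrow> table \<Rightarrow> table \<Rightarrow> bool" where
  "relabels ss (xs, ys) (us, vs) \<longleftrightarrow>
    map ((!) ss) xs = map ((!) us) ss \<and> map ((!) ss) ys = map ((!) vs) ss"

declare transitive_table.simps [simp del] relabels.simps [simp del]

text \<open>
  \<open>R\<close> contains each involutive, transitive pair of permutations in \<open>P\<close> exactly once up to
  renumbering.  The order condition concerns the entries of \<open>R\<close> only, since these are the pairs from
  which actions get constructed.  The list \<open>P\<close> stands for \<open>perms n\<close>; it is a parameter so that an
  evaluation computes it a single time.
\<close>
definition transversal :: "nat list list \<Rightarrow> nat \<Rightarrow> table list \<Rightarrow> bool" where
  "transversal P m R \<longleftrightarrow>
    (\<forall>(us, vs)\<in>set R. us \<in> set P \<and> vs \<in> set P \<and> involutive us \<and> order_dvd m vs \<and>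
       transitive_table (us, vs)) \<and>
    (\<forall>s\<in>set R. \<forall>t\<in>set R. s \<noteq> t \<longrightarrow> (\<forall>ss\<in>set P. \<not> relabels ss s t)) \<and>
    (\<forall>xs\<in>set P. involutive xs \<longrightarrow> (\<forall>ys\<in>set P. transitive_table (xs, ys) \<longrightarrow>
       (\<exists>t\<in>set R. \<exists>ss\<in>set P. relabels ss (xs, ys) t)))"

lemma
  assumes "transversal P m R"
  shows transversal_valid: "(us, vs) \<in> set R \<Longrightarrow> us \<in> set P \<and> vs \<in> set P \<and> involutive us \<and>
      order_dvd m vs \<and> transitive_table (us, vs)"
    and transversal_irredundant: "s \<in> set R \<Longrightarrow> t \<in> set R \<Longrightarrow> ss \<in> set P \<Longrightarrow> relabels ss s t \<Longrightarrow> s = t"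
    and transversal_complete: "xs \<in> set P \<Longrightarrow> ys \<in> set P \<Longrightarrow> involutive xs \<Longrightarrow>
      transitive_table (xs, ys) \<Longrightarrow> \<exists>t\<in>set R. \<exists>ss\<in>set P. relabels ss (xs, ys) t"
proof -
  note R = assms[unfolded transversal_def]
  show "(us, vs) \<in> set R \<Longrightarrow> us \<in> set P \<and> vs \<in> set P \<and> involutive us \<and>
      order_dvd m vs \<and> transitive_table (us, vs)"
    by (drule bspec[OF conjunct1[OF R]]) simp
  show "s \<in> set R \<Longrightarrow> t \<in> set R \<Longrightarrow> ss \<in> set P \<Longrightarrow> relabels ss s t \<Longrightarrow> s = t"
    using conjunct1[OF conjunct2[OF R]] by blast
  show "xs \<in> set P \<Longrightarrow> ys \<in> set P \<Longrightarrow> involutive xs \<Longrightarrow>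
      transitive_table (xs, ys) \<Longrightarrow> \<exists>t\<in>set R. \<exists>ss\<in>set P. relabels ss (xs, ys) t"
    using conjunct2[OF conjunct2[OF R]] by blast
qed

lemma mem_perms_iff: "xs \<in> set (perms n) \<longleftrightarrow> length xs = n \<and> distinct xs \<and> set xs \<subseteq> {..<n}"
  by (auto simp: perms_def set_n_lists)

lemma bij_betw_perms:
  assumes "xs \<in> set (perms n)"
  shows "bij_betw ((!) xs) {..<n} {..<n}"
proof -
  have "card (set xs) = n" using assms by (auto simp: mem_perms_iff distinct_card)
  then have "set xs = {..<n}"
    using assms by (intro card_subset_eq) (auto simp: mem_perms_iff)
  then show ?thesis using assms by (auto simp: mem_perms_iff intro!: bij_betw_nth)
qed

lemma perms_of_bij:
  assumes "bij_betw f {..<n} {..<n}"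
  shows "map f [0..<n] \<in> set (perms n)"
  using assms by (auto simp: mem_perms_iff bij_betw_def distinct_map atLeast0LessThan)

lemma transitive_table_iff:
  "transitive_table (xs, ys) \<longleftrightarrow>
    (\<forall>T\<subseteq>{..<length xs}. 0 \<in> T \<longrightarrow> (\<forall>i\<in>T. xs ! i \<in> T \<and> ys ! i \<in> T) \<longrightarrow> T = {..<length xs})"
proof -
  define Q where "Q T \<longleftrightarrow> (0 \<in> T \<longrightarrow> (\<forall>i\<in>T. xs ! i \<in> T \<and> ys ! i \<in> T) \<longrightarrow> {..<length xs} \<subseteq> T)" for T
  have "transitive_table (xs, ys) \<longleftrightarrow> (\<forall>T\<in>set ` set (subseqs [0..<length xs]). Q T)"
    by (simp add: transitive_table.simps Q_def subset_eq atLeast0LessThan)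
  also have "set ` set (subseqs [0..<length xs]) = Pow {..<length xs}"
    by (simp add: subseqs_powset atLeast0LessThan)
  finally show ?thesis by (auto simp: Q_def)
qed

lemma BijGroup_restrict_pow:
  assumes "bij_betw f S S"
  shows "(restrict f S) [^]\<^bsub>BijGroup S\<^esub> k = restrict (f ^^ k) S"
proof (induction k)
  case 0
  then show ?case by (simp add: BijGroup_def nat_pow_def restrict_def)
next
  case (Suc k)
  have B: "restrict g S \<in> Bij S" if "bij_betw g S S" for g
    using that by (simp add: Bij_def)
  have "bij_betw (f ^^ k) S S" using assms by (rule bij_betw_funpow)
  with B assms have "restrict (f ^^ k) S \<otimes>\<^bsub>BijGroup S\<^esub> restrict f S
      = compose S (restrict (f ^^ k) S) (restrict f S)"
    by (simp add: BijGroup_def)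
  also have "\<dots> = restrict (f ^^ Suc k) S"
    using bij_betwE[OF assms] by (auto simp: compose_def funpow_swap1 fun_eq_iff)
  finally show ?case by (simp only: Group.nat_pow_Suc Suc.IH)
qed


section \<open>Actions of the Hecke group as pairs of permutations\<close>

text \<open>
  What the counting needs from \<open>\<langle>a, b | a\<^sup>2 = b\<^sup>p = e\<rangle>\<close>: generation, the relation for \<open>a\<close>, which makes
  every action give an involutive table, and the universal property for permutation groups, which
  makes every suitable table give an action.
\<close>
locale hecke_group = group K for K (structure) +
  fixes a b and p :: nat
  assumes a: "a \<in> carrier K" and b: "b \<in> carrier K"
    and gen: "generate K {a, b} = carrier K"
    and a_square: "a \<otimes> a = \<one>"
    and universal: "\<And>(S :: nat set) x y. x \<in> Bij S \<Longrightarrow> y \<in> Bij S \<Longrightarrow>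
      x \<otimes>\<^bsub>BijGroup S\<^esub> x = \<one>\<^bsub>BijGroup S\<^esub> \<Longrightarrow> y [^]\<^bsub>BijGroup S\<^esub> p = \<one>\<^bsub>BijGroup S\<^esub> \<Longrightarrow>
      \<exists>\<phi>\<in>hom K (BijGroup S). \<phi> a = x \<and> \<phi> b = y"
begin

definition table_of :: "nat \<Rightarrow> ('a \<Rightarrow> nat \<Rightarrow> nat) \<Rightarrow> table" where
  "table_of n \<phi> = (map (\<phi> a) [0..<n], map (\<phi> b) [0..<n])"

lemma table_of_in_perms:
  assumes "group_action K {..<n} \<phi>"
  shows "fst (table_of n \<phi>) \<in> set (perms n)" "snd (table_of n \<phi>) \<in> set (perms n)"
    and "involutive (fst (table_of n \<phi>))"
proof -
  interpret group_action K "{..<n}" \<phi> by fact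
  show "fst (table_of n \<phi>) \<in> set (perms n)" "snd (table_of n \<phi>) \<in> set (perms n)"
    using bij_prop0[OF a] bij_prop0[OF b] by (auto simp: table_of_def Bij_def intro!: perms_of_bij)
  have "\<phi> a i < n" "\<phi> a (\<phi> a i) = i" if "i < n" for i
    using that composition_rule[of i a a] image_one[of i] element_image[OF a, of i] a
    by (auto simp: a_square)
  then show "involutive (fst (table_of n \<phi>))"
    by (auto simp: table_of_def involutive_def intro!: nth_equalityI)
qed

text \<open>
  The orbit of \<open>0\<close> is a set closed under both generators, and conversely every such set is closed
  under the whole group.
\<close>
lemma transitive_table_of:
  assumes "group_action K {..<n} \<phi>" and n: "n > 0"
  shows "transitive_table (table_of n \<phi>) \<longleftrightarrow> transitive_action K {..<n} \<phi>"
proof -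
  interpret group_action K "{..<n}" \<phi> by fact
  have tt: "transitive_table (table_of n \<phi>) \<longleftrightarrow>
    (\<forall>T\<subseteq>{..<n}. 0 \<in> T \<longrightarrow> \<phi> a ` T \<subseteq> T \<and> \<phi> b ` T \<subseteq> T \<longrightarrow> T = {..<n})"
  proof -
    have "(\<forall>i\<in>T. map (\<phi> a) [0..<n] ! i \<in> T \<and> map (\<phi> b) [0..<n] ! i \<in> T)
        \<longleftrightarrow> \<phi> a ` T \<subseteq> T \<and> \<phi> b ` T \<subseteq> T" if "T \<subseteq> {..<n}" for T
      using that by (auto simp: image_subset_iff subset_iff)
    then show ?thesis by (simp add: table_of_def transitive_table_iff cong: imp_cong)
  qed
  show ?thesis
  proof
    assume t: "transitive_table (table_of n \<phi>)"
    let ?T = "{\<phi> g 0 |g. g \<in> carrier K}"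
    have T: "?T \<subseteq> {..<n}" using element_image n by blast
    have closed: "\<phi> h ` ?T \<subseteq> ?T" if h: "h \<in> carrier K" for h
    proof (intro image_subsetI, elim CollectE exE conjE)
      fix i g assume "i = \<phi> g 0" "g \<in> carrier K"
      then have "\<phi> h i = \<phi> (h \<otimes> g) 0" "h \<otimes> g \<in> carrier K"
        using h n by (simp_all add: composition_rule)
      then show "\<phi> h i \<in> ?T" by blast
    qed
    have zero: "0 \<in> ?T" using image_one[of 0] n by force
    have all: "?T = {..<n}"
      by (rule t[unfolded tt, rule_format, OF T zero conjI[OF closed[OF a] closed[OF b]]])
    show "transitive_action K {..<n} \<phi>"
    proof
      fix i j assume "i \<in> {..<n}" "j \<in> {..<n}"
      moreover from this have "i \<in> ?T" "j \<in> ?T" by (simp_all only: all)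
      ultimately obtain g h where gh: "g \<in> carrier K" "h \<in> carrier K" "i = \<phi> g 0" "j = \<phi> h 0"
        by blast
      then have "\<phi> (inv g) i = 0" using orbit_sym_aux[of g 0] n by simp
      then have "\<phi> (h \<otimes> inv g) i = j"
        using gh \<open>i \<in> {..<n}\<close> by (simp add: composition_rule)
      then show "\<exists>g\<in>carrier K. \<phi> g i = j" using gh by blast
    qed
  next
    assume "transitive_action K {..<n} \<phi>"
    then interpret transitive_action K "{..<n}" \<phi> .
    show "transitive_table (table_of n \<phi>)"
      unfolding tt
    proof (intro allI impI)
      fix T assume T: "T \<subseteq> {..<n}" "0 \<in> T" "\<phi> a ` T \<subseteq> T \<and> \<phi> b ` T \<subseteq> T"
      have "\<phi> g ` T \<subseteq> T" if "g \<in> carrier K" for g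
        by (rule closed_if_closed_under_generators[where A = "{a, b}"])
          (use T a b gen that finite_subset[OF T(1)] in auto)
      then have "i \<in> T" if "i < n" for i
        using T(2) unique_orbit[of 0 i] that n by auto
      then show "T = {..<n}" using T(1) by auto
    qed
  qed
qed

lemma action_with_table:
  assumes us: "us \<in> set (perms n)" and vs: "vs \<in> set (perms n)"
    and inv: "involutive us" and ord: "order_dvd m vs" and m: "m dvd p"
  shows "\<exists>\<phi>. group_action K {..<n} \<phi> \<and> table_of n \<phi> = (us, vs)"
proof -
  let ?x = "restrict ((!) us) {..<n}" and ?y = "restrict ((!) vs) {..<n}"
  have len: "length us = n" "length vs = n" using us vs by (auto simp: mem_perms_iff)
  have Bij: "?x \<in> Bij {..<n}" "?y \<in> Bij {..<n}"
    using bij_betw_perms[OF us] bij_betw_perms[OF vs] by (auto simp: Bij_def)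
  have "us ! (us ! i) = i" if "i < n" for i
    using inv that len by (auto simp: involutive_def dest: arg_cong[of _ _ "\<lambda>xs. xs ! i"])
  then have x: "?x \<otimes>\<^bsub>BijGroup {..<n}\<^esub> ?x = \<one>\<^bsub>BijGroup {..<n}\<^esub>"
    using Bij bij_betwE[OF bij_betw_perms[OF us]]
    by (auto simp: BijGroup_def compose_def fun_eq_iff)
  have "(map f ^^ k) xs = map (f ^^ k) xs" for f :: "nat \<Rightarrow> nat" and k xs
    by (induction k) auto
  with ord have "map ((!) vs ^^ m) [0..<n] = map id [0..<n]"
    by (simp add: order_dvd_def len)
  then have "((!) vs ^^ m) i = i" if "i < n" for i
    using that by (auto dest: arg_cong[of _ _ "\<lambda>xs. xs ! i"])
  then have "?y [^]\<^bsub>BijGroup {..<n}\<^esub> m = \<one>\<^bsub>BijGroup {..<n}\<^esub>"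
    unfolding BijGroup_restrict_pow[OF bij_betw_perms[OF vs]] by (auto simp: BijGroup_def fun_eq_iff)
  moreover have carrier: "?y \<in> carrier (BijGroup {..<n})" using Bij by (simp add: BijGroup_def)
  moreover obtain q where "p = m * q" using m by blast
  ultimately have y: "?y [^]\<^bsub>BijGroup {..<n}\<^esub> p = \<one>\<^bsub>BijGroup {..<n}\<^esub>"
    by (metis group.is_monoid group_BijGroup monoid.nat_pow_one monoid.nat_pow_pow)
  obtain \<phi> where \<phi>: "\<phi> \<in> hom K (BijGroup {..<n})" "\<phi> a = ?x" "\<phi> b = ?y"
    using universal[OF Bij x y] by blast
  then have "group_action K {..<n} \<phi>"
    by (intro group_action.intro group_hom.intro group_hom_axioms.intro group_BijGroup is_group)
  moreover have "table_of n \<phi> = (us, vs)"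
    using \<phi> len by (auto simp: table_of_def intro!: nth_equalityI)
  ultimately show ?thesis by blast
qed

text \<open>
  Renumberings of tables are the isomorphisms of actions; it suffices to look at the generators.
\<close>
lemma relabels_iff:
  assumes ss: "ss \<in> set (perms n)" and \<phi>: "group_action K {..<n} \<phi>" and \<psi>: "group_action K {..<n} \<psi>"
  shows "relabels ss (table_of n \<phi>) (table_of n \<psi>) \<longleftrightarrow>
    (\<forall>g\<in>carrier K. \<forall>i<n. ss ! \<phi> g i = \<psi> g (ss ! i))"
proof -
  have len: "length ss = n" and lt: "\<And>i. i < n \<Longrightarrow> ss ! i < n"
    using ss nth_mem by (force simp: mem_perms_iff)+
  have *: "map ((!) ss) (map f [0..<n]) = map ((!) (map g [0..<n])) ss \<longleftrightarrow>
      (\<forall>i<n. ss ! f i = g (ss ! i))" for f g :: "nat \<Rightarrow> nat"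
    by (auto simp: list_eq_iff_nth_eq len lt)
  have "relabels ss (table_of n \<phi>) (table_of n \<psi>) \<longleftrightarrow>
      (\<forall>g\<in>{a, b}. \<forall>i\<in>{..<n}. ss ! \<phi> g i = \<psi> g (ss ! i))"
    unfolding table_of_def relabels.simps * by auto
  also have "\<dots> \<longleftrightarrow> (\<forall>g\<in>carrier K. \<forall>i\<in>{..<n}. ss ! \<phi> g i = \<psi> g (ss ! i))"
  proof
    assume on_gens: "\<forall>g\<in>{a, b}. \<forall>i\<in>{..<n}. ss ! \<phi> g i = \<psi> g (ss ! i)"
    show "\<forall>g\<in>carrier K. \<forall>i\<in>{..<n}. ss ! \<phi> g i = \<psi> g (ss ! i)"
    proof (intro ballI)
      fix g i assume g: "g \<in> carrier K" and i: "i \<in> {..<n}"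
      have AK: "{a, b} \<subseteq> carrier K" using a b by simp
      have maps: "ss ! i \<in> {..<n}" if "i \<in> {..<n}" for i using lt that by simp
      show "ss ! \<phi> g i = \<psi> g (ss ! i)"
        using equivariant_if_on_generators[where \<sigma> = "(!) ss", OF \<phi> \<psi> AK maps
            on_gens[rule_format] g[folded gen] i] .
    qed
  qed (use a b in auto)
  finally show ?thesis by (simp add: Ball_def)
qed

text \<open>
  To each table in \<open>R\<close> belongs an action, whose point stabilizers form one conjugacy class of
  subgroups of index \<open>n\<close>.  Two equal classes share a stabilizer, so the actions are isomorphic and
  the tables renumber each other; and a given subgroup is a stabilizer in its coset action, whose
  table renumbers to one in \<open>R\<close>.
\<close>
theorem card_conjugacy_classes_of_index:
  assumes n: "n > 0" and m: "m dvd p" and R: "transversal (perms n) m R"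
  shows "card (conjugacy_classes_of_index K n) = card (set R)"
proof -
  have "\<exists>\<phi>. transitive_action K {..<n} \<phi> \<and> table_of n \<phi> = t" if t: "t \<in> set R" for t
  proof -
    obtain us vs where "t = (us, vs)" by force
    note valid = transversal_valid[OF R t[unfolded \<open>t = (us, vs)\<close>]]
    then obtain \<phi> where \<phi>: "group_action K {..<n} \<phi>" "table_of n \<phi> = t"
      using action_with_table[of us n vs m] m \<open>t = (us, vs)\<close> by metis
    then have "transitive_action K {..<n} \<phi>"
      using valid \<open>t = (us, vs)\<close> by (simp flip: transitive_table_of[OF \<phi>(1) n])
    with \<phi> show ?thesis by blast
  qed
  then obtain \<Phi> where \<Phi>: "\<And>t. t \<in> set R \<Longrightarrow> transitive_action K {..<n} (\<Phi> t)"
      and table: "\<And>t. t \<in> set R \<Longrightarrow> table_of n (\<Phi> t) = t"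
    by metis
  have \<Phi>': "group_action K {..<n} (\<Phi> t)" if "t \<in> set R" for t
    using \<Phi>[OF that] by (rule transitive_action.axioms)
  let ?cl = "\<lambda>t. stabilizer K (\<Phi> t) ` {..<n}"
  have "inj_on ?cl (set R)"
  proof
    fix s t assume st: "s \<in> set R" "t \<in> set R" "?cl s = ?cl t"
    have "stabilizer K (\<Phi> s) 0 \<in> ?cl s" using n by simp
    then obtain j where j: "j < n" "stabilizer K (\<Phi> s) 0 = stabilizer K (\<Phi> t) j"
      unfolding st(3) by auto
    then obtain \<sigma> where \<sigma>: "bij_betw \<sigma> {..<n} {..<n}"
        "\<forall>g\<in>carrier K. \<forall>i\<in>{..<n}. \<sigma> (\<Phi> s g i) = \<Phi> t g (\<sigma> i)"
      using stabilizers_eq_imp_isomorphic_actions[OF \<Phi>[OF st(1)] \<Phi>[OF st(2)], of 0 j] n by auto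
    define ss where "ss = map \<sigma> [0..<n]"
    have ss: "ss \<in> set (perms n)" unfolding ss_def by (rule perms_of_bij[OF \<sigma>(1)])
    have "relabels ss (table_of n (\<Phi> s)) (table_of n (\<Phi> t))"
      unfolding relabels_iff[OF ss \<Phi>'[OF st(1)] \<Phi>'[OF st(2)]]
      using \<sigma>(2) group_action.element_image[OF \<Phi>'[OF st(1)]] by (fastforce simp: ss_def)
    then show "s = t"
      unfolding table[OF st(1)] table[OF st(2)] by (rule transversal_irredundant[OF R st(1,2) ss])
  qed
  moreover have "?cl ` set R = conjugacy_classes_of_index K n"
  proof (intro subset_antisym subsetI)
    fix C assume "C \<in> ?cl ` set R"
    then obtain t where t: "t \<in> set R" "C = ?cl t" by auto
    then show "C \<in> conjugacy_classes_of_index K n"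
      using transitive_action.stabilizer_in_subgroups_of_index[OF \<Phi>[OF t(1)], of 0]
        orbit_stabilizer_conjugation[OF \<Phi>[OF t(1)], of 0] n
      by (auto simp: conjugacy_classes_of_index_def orbits_def)
  next
    fix C assume "C \<in> conjugacy_classes_of_index K n"
    then obtain H where H: "H \<in> subgroups_of_index K n"
        and C: "C = orbit K (\<lambda>g H. g <# H #> inv g) H"
      by (auto simp: conjugacy_classes_of_index_def orbits_def)
    then obtain \<phi> k where \<phi>: "transitive_action K {..<n} \<phi>" and k: "k < n" "stabilizer K \<phi> k = H"
      using action_on_cosets[of H n] n by (auto simp: subgroups_of_index_def)
    note \<phi>' = transitive_action.axioms(1)[OF \<phi>]
    have "transitive_table (fst (table_of n \<phi>), snd (table_of n \<phi>))"
      using transitive_table_of[OF \<phi>' n] \<phi> by simp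
    from transversal_complete[OF R table_of_in_perms[OF \<phi>'] this]
    obtain t ss where t: "t \<in> set R" and ss: "ss \<in> set (perms n)"
        and "relabels ss (table_of n \<phi>) t"
      by auto
    then have "relabels ss (table_of n \<phi>) (table_of n (\<Phi> t))" by (simp add: table)
    then have "stabilizer K (\<Phi> t) (ss ! k) = H"
      unfolding relabels_iff[OF ss \<phi>' \<Phi>'[OF t]]
      using stabilizer_eq_if_equivariant[OF \<phi>' bij_betw_imp_inj_on[OF bij_betw_perms[OF ss]], of k] k
      by auto
    then have "C = ?cl t"
      using orbit_stabilizer_conjugation[OF \<Phi>[OF t], of "ss ! k"] bij_betwE[OF bij_betw_perms[OF ss]] k
      by (auto simp: C)
    then show "C \<in> ?cl ` set R" using t by blast
  qed
  ultimately show ?thesis using card_image by metis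
qed

end

lemma word_class_in_generate:
  "word_class R u \<in> generate (presented_group R) (range (\<lambda>x. word_class R [(x, True)]))"
    (is "_ \<in> generate ?G ?A")
proof (induction u)
  case Nil
  show ?case using generate.one[of ?G ?A] by (simp add: presented_group_one)
next
  case (Cons l u)
  obtain x s where l: "l = (x, s)" by force
  have gens: "word_class R [(x, True)] \<in> ?A" by blast
  have "word_class R [(x, False)] \<otimes>\<^bsub>?G\<^esub> word_class R [(x, True)] = \<one>\<^bsub>?G\<^esub>"
    using word_eq.cancel[of R "[]" x False "[]"]
    by (simp add: presented_group_one word_class_eq_iff)
  then have "inv\<^bsub>?G\<^esub> word_class R [(x, True)] = word_class R [(x, False)]"
    by (intro group.inv_equality[OF group_presented_group]) (auto simp: presented_group_carrier)
  then have "word_class R [(x, s)] \<in> generate ?G ?A"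
    using generate.incl[OF gens] generate.inv[OF gens, of ?G] by (cases s) auto
  from generate.eng[OF this Cons.IH] show ?case by (simp add: l)
qed

lemma (in group) word_val_replicate:
  assumes "f x \<in> carrier G"
  shows "word_val G f (replicate k (x, True)) = f x [^] k"
proof (induction k)
  case (Suc k)
  then show ?case using nat_pow_Suc2[OF assms, of k] by simp
qed simp

text \<open>
  The universal property is von Dyck's theorem, transported along the isomorphism.
\<close>
lemma hecke_group_if_iso_presentation:
  fixes K (structure)
  assumes K: "group K" and iso: "K \<cong> hecke_presentation p"
  shows "\<exists>a b. hecke_group K a b p"
proof -
  interpret group K by fact
  define R where "R = {replicate 2 (X, True), replicate p (Y, True)}"
  let ?G = "presented_group R"
  interpret G: group ?G by (rule group_presented_group)
  have "?G \<cong> K"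
    using iso by (simp add: iso_sym hecke_presentation_def R_def)
  then obtain h where h: "h \<in> iso ?G K" by (auto simp: is_iso_def)
  then have hom: "h \<in> hom ?G K" and onto: "h ` carrier ?G = carrier K"
    by (auto simp: iso_def bij_betw_def)
  interpret h: group_hom ?G K h by unfold_locales (rule hom)
  define g where "g x = word_class R [(x, True)]" for x
  have g: "g x \<in> carrier ?G" for x by (simp add: g_def presented_group_carrier)
  have "hecke_group K (h (g X)) (h (g Y)) p"
  proof
    show "h (g X) \<in> carrier K" "h (g Y) \<in> carrier K" using g by auto
    have "(UNIV :: hecke_gen set) = {X, Y}" using hecke_gen.exhaust by auto
    then have "range g = g ` {X, Y}" by (rule arg_cong)
    then have "range g = {g X, g Y}" by simp
    then have "carrier ?G \<subseteq> generate ?G {g X, g Y}"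
      using word_class_in_generate[of R] by (auto simp: presented_group_carrier g_def)
    then have "generate ?G {g X, g Y} = carrier ?G"
      using G.generate_incl[of "{g X, g Y}"] g by auto
    then show "generate K {h (g X), h (g Y)} = carrier K"
      using h.generate_img[of "{g X, g Y}"] g onto by simp
    have "word_class R [(X, True), (X, True)] = word_class R []"
      using word_eq.relator[of "replicate 2 (X, True)" R "[]" "[]"]
      by (simp add: word_class_eq_iff R_def numeral_2_eq_2)
    then have "g X \<otimes>\<^bsub>?G\<^esub> g X = \<one>\<^bsub>?G\<^esub>" by (simp add: g_def presented_group_one)
    then show "h (g X) \<otimes> h (g X) = \<one>" using g by (simp flip: h.hom_mult)
  next
    fix S :: "nat set" and x y
    let ?B = "BijGroup S"
    assume xy: "x \<in> Bij S" "y \<in> Bij S"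
      and rel: "x \<otimes>\<^bsub>?B\<^esub> x = \<one>\<^bsub>?B\<^esub>" "y [^]\<^bsub>?B\<^esub> p = \<one>\<^bsub>?B\<^esub>"
    interpret B: group ?B by (rule group_BijGroup)
    have xyB: "x \<in> carrier ?B" "y \<in> carrier ?B" using xy by (simp_all add: BijGroup_def)
    define f where "f c = (case c of X \<Rightarrow> x | Y \<Rightarrow> y)" for c
    have f: "f X = x" "f Y = y" by (simp_all add: f_def)
    have "range f \<subseteq> carrier ?B" using xyB by (auto simp: f_def split: hecke_gen.split)
    moreover have "word_val ?B f r = \<one>\<^bsub>?B\<^esub>" if "r \<in> R" for r
      using that xyB rel by (auto simp: R_def B.word_val_replicate f numeral_2_eq_2)
    ultimately obtain \<psi> where \<psi>: "\<psi> \<in> hom ?G ?B" "\<forall>c. \<psi> (g c) = f c"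
      using B.von_dyck[of f R] unfolding g_def by blast
    let ?k = "inv_into (carrier ?G) h"
    have "?k \<in> hom K ?G" using G.iso_set_sym[OF h] by (simp add: iso_def)
    then have "\<psi> \<circ> ?k \<in> hom K ?B" using \<psi>(1) by (rule Group.hom_compose)
    moreover have "?k (h (g c)) = g c" for c
      using h g by (intro inv_into_f_f) (auto simp: iso_def bij_betw_def)
    ultimately show "\<exists>\<phi>\<in>hom K ?B. \<phi> (h (g X)) = x \<and> \<phi> (h (g Y)) = y"
      using \<psi>(2) f by (intro bexI[of _ "\<psi> \<circ> ?k"]) auto
  qed
  then show ?thesis by blast
qed


section \<open>Representatives for the indices 2, 3 and 4\<close>

definition index_2_tables :: "table list" where
  "index_2_tables = [([0,1],[1,0]), ([1,0],[0,1]), ([1,0],[1,0])]"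

definition index_3_tables :: "table list" where
  "index_3_tables = [([0,1,2],[1,2,0]), ([1,0,2],[0,2,1]), ([1,0,2],[1,2,0])]"

text \<open>
  The involution is the identity, \<open>(0 1)\<close> or \<open>(0 1)(2 3)\<close>; the pairs below are listed in this order.
  Two permutations \<open>y\<close> give the same class exactly if they are conjugate under the centralizer
  of the involution.  For \<open>(0 1)(2 3)\<close> the five \<open>y\<close> are a transposition, a 3-cycle, a double transposition,
  a 4-cycle with square \<open>(0 1)(2 3)\<close> and a 4-cycle with another square, in this order.
\<close>
definition index_4_tables :: "table list" where
  "index_4_tables =
    [([0,1,2,3],[1,2,3,0]),
     ([1,0,2,3],[1,2,3,0]), ([1,0,2,3],[2,3,1,0]), ([1,0,2,3],[0,2,3,1]), ([1,0,2,3],[2,3,0,1]),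
     ([1,0,3,2],[0,2,1,3]), ([1,0,3,2],[0,2,3,1]), ([1,0,3,2],[2,3,0,1]), ([1,0,3,2],[2,3,1,0]),
     ([1,0,3,2],[1,2,3,0])]"

text \<open>
  The second arguments 2, 6 and 12 are the exponents of the symmetric groups on 2, 3 and 4 points.
\<close>
lemma transversal_index_2: "transversal (perms 2) 2 index_2_tables"
  by code_simp

lemma transversal_index_3: "transversal (perms 3) 6 index_3_tables"
  by code_simp

lemma transversal_index_4: "transversal (perms 4) 12 index_4_tables"
  by code_simp

theorem theorem3:
  fixes K :: "('g, 'm) monoid_scheme" and p :: nat
  assumes "p \<ge> 3"
    and "group K"
    and "K \<cong> hecke_presentation p"
  shows "(2 dvd p \<longrightarrow> card (subgroups_of_index K 2) = 3) \<and>
         (2 dvd p \<and> 3 dvd p \<longrightarrow> card (conjugacy_classes_of_index K 3) = 3) \<and>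
         (2 dvd p \<and> 3 dvd p \<and> 4 dvd p \<longrightarrow> card (conjugacy_classes_of_index K 4) = 10)"
proof -
  obtain a b where "hecke_group K a b p"
    using hecke_group_if_iso_presentation assms(2,3) by blast
  then interpret hecke_group K a b p .
  have "card (subgroups_of_index K 2) = 3" if "2 dvd p"
    using card_conjugacy_classes_of_index[OF _ that transversal_index_2]
    by (simp add: card_subgroups_of_index_2 index_2_tables_def)
  moreover have "card (conjugacy_classes_of_index K 3) = 3" if "2 dvd p" "3 dvd p"
  proof -
    have "6 dvd p" using that by presburger
    from card_conjugacy_classes_of_index[OF _ this transversal_index_3]
    show ?thesis by (simp add: index_3_tables_def)
  qed
  moreover have "card (conjugacy_classes_of_index K 4) = 10" if "3 dvd p" "4 dvd p"
  proof -
    have "12 dvd p" using that by presburger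
    from card_conjugacy_classes_of_index[OF _ this transversal_index_4]
    show ?thesis by (simp add: index_4_tables_def)
  qed
  ultimately show ?thesis by blast
qed

end
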